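(* Let $1\le k\le n$ be integers, let $f:[0,\infty)\to(0,\infty)$ and $g:(-\infty,0]\to(0,\infty)$ be continuous, and suppose there are constants with $0<m_f\le f\le M_f<\infty$ on $[0,\infty)$ and $0<m_g\le g\le M_g<\infty$ on $(-\infty,0]$. Suppose $\alpha>\max\{0,\frac{2k-n}{kn}\}$. Let $u(x,t)=w(t)v(|x|)$ be the constructed separable solution of $-u_t(\sigma_k(\lambda(D^2u)))^{\alpha}=f(|x|)g(t)$ in $\mathbb{R}^n\times(-\infty,0]$ (defined in the context, normalized by $v(0)=1$). Then $u(x,t)\to\infty$ if and only if $-t+|x|^2\to\infty$; that is, for any sequence $(x^{(i)},t^{(i)})$ in $\mathbb{R}^n\times(-\infty,0]$, $u(x^{(i)},t^{(i)})\to\infty$ if and only if $-t^{(i)}+|x^{(i)}|^2\to\infty$. Moreover, there exist two constants $\Lambda_1$ and $\Lambda_2$ depending on $n,k,\alpha$ and $f$ such that $$\Lambda_1 r^{\frac{2k\alpha}{k\alpha+1}}\le v(r)\le 1+\Lambda_2 r^{\frac{2k\alpha}{k\alpha+1}},\quad r\ge0.$$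
   Context: $\sigma_k$ is the $k$-th elementary symmetric function, $\lambda(D^2u)$ the eigenvalues of the Hessian of $u$ in $x$, and $C_n^k=\binom{n}{k}$. For $\alpha>0$, the constructed separable solution is $u(x,t)=w(t)v(|x|)$, where $$w(t)=(k\alpha+1)^{\frac1{k\alpha+1}}\Bigl(1+\int_t^0 g(s)\,ds\Bigr)^{\frac1{k\alpha+1}},\quad t\le0,$$ and $v\in C^2([0,\infty))$, $v>0$, is the unique solution of the initial value problem $$v'(r)=\Bigl(\frac{n r^{k-n}}{C_n^k}\int_0^r s^{n-1}\Bigl(\frac{f(s)}{v(s)}\Bigr)^{1/\alpha}ds\Bigr)^{1/k}\ (r>0),\qquad v(0)=1.$$ *)

theory Defs
  imports "HOL-Analysis.Analysis"
begin

text \<open>Class \<open>C\<^sup>2([0,\<infinity>))\<close>: the derivatives at the endpoint 0 are one-sided, and values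
  at negative arguments play no role.\<close>

definition C2_halfline :: "(real \<Rightarrow> real) \<Rightarrow> bool" where
  "C2_halfline v \<longleftrightarrow>
     (\<exists>v1 v2. (\<forall>r\<ge>0. (v has_real_derivative v1 r) (at r within {0..})) \<and>
              (\<forall>r\<ge>0. (v1 has_real_derivative v2 r) (at r within {0..})) \<and>
              continuous_on {0..} v2)"

text \<open>Since \<open>k - n \<le> 0\<close>, the factor \<open>r\<^bsup>k-n\<^esup>\<close> needs an integer (not natural) exponent.\<close>

definition radial_solution ::
    "nat \<Rightarrow> nat \<Rightarrow> real \<Rightarrow> (real \<Rightarrow> real) \<Rightarrow> (real \<Rightarrow> real) \<Rightarrow> bool" where
  "radial_solution n k \<alpha> f v \<longleftrightarrow>
     C2_halfline v \<and> (\<forall>r\<ge>0. v r > 0) \<and> v 0 = 1 \<and>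
     (\<forall>r>0. (v has_real_derivative
        (real n * r powi (int k - int n) / real (n choose k) *
          integral {0..r} (\<lambda>s. s ^ (n - 1) * (f s / v s) powr (1 / \<alpha>))) powr (1 / real k))
        (at r))"

definition time_factor :: "nat \<Rightarrow> real \<Rightarrow> (real \<Rightarrow> real) \<Rightarrow> real \<Rightarrow> real" where
  "time_factor k \<alpha> g t =
     (real k * \<alpha> + 1) powr (1 / (real k * \<alpha> + 1)) *
     (1 + integral {t..0} g) powr (1 / (real k * \<alpha> + 1))"

text \<open>The separable function \<open>u(x,t) = w(t) v(|x|)\<close>. With \<open>v\<close> a \<open>radial_solution\<close> for
  \<open>n = CARD('n)\<close>, it is the constructed solution of
  \<open>-u\<^sub>t (\<sigma>\<^sub>k(\<lambda>(D\<^sup>2u)))\<^sup>\<alpha> = f(|x|) g(t)\<close>, the equations for \<open>v\<close> and \<open>w\<close> being what this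
  equation becomes on separating variables.\<close>

definition separable_solution ::
    "nat \<Rightarrow> real \<Rightarrow> (real \<Rightarrow> real) \<Rightarrow> (real \<Rightarrow> real) \<Rightarrow> real ^ 'n \<Rightarrow> real \<Rightarrow> real" where
  "separable_solution k \<alpha> g v x t = time_factor k \<alpha> g t * v (norm x)"

end

theory Submission
  imports Defs
begin

text \<open>The profile \<open>v\<close> is nondecreasing, so \<open>v s \<le> v r\<close> under the integral for \<open>s \<le> r\<close>. This
  turns the integral equation into the differential inequality
  \<open>v\<^bsup>1/(k\<alpha>)\<^esup> v' \<ge> A r\<close>, which integrates to \<open>v\<^bsup>p\<^esup> \<ge> 1 + (p A / 2) r\<^sup>2\<close> with
  \<open>p = (k\<alpha> + 1)/(k\<alpha>)\<close>, and hence gives \<open>v r \<ge> \<Lambda>\<^sub>1 r\<^bsup>q\<^esup>\<close> with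
  \<open>q = 2/p = 2k\<alpha>/(k\<alpha> + 1)\<close> (\<open>profile_lower_bound\<close>).

  The lower bound is then fed back into the equation: under the integral it bounds
  \<open>(f/v)\<^bsup>1/\<alpha>\<^esup>\<close> from above by a multiple of \<open>s\<^bsup>-q/\<alpha>\<^esup>\<close>, where \<open>q/\<alpha> = 2k/(k\<alpha> + 1)\<close>. The resulting
  integral of \<open>s\<^bsup>n-1-q/\<alpha>\<^esup>\<close> converges at 0 precisely when \<open>n > 2k/(k\<alpha> + 1)\<close>, and this
  is the hypothesis \<open>\<alpha> > (2k - n)/(kn)\<close>. The outcome is \<open>v' \<le> B r\<^bsup>q-1\<^esup>\<close>, so
  \<open>v \<le> 1 + (B/q) r\<^bsup>q\<^esup>\<close> (\<open>profile_upper_bound\<close>).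

  Since \<open>g\<close> lies between two positive constants, the time factor is comparable to
  \<open>(1 - t)\<^bsup>1/(k\<alpha>+1)\<^esup>\<close>. Both factors of \<open>u\<close> are bounded away from zero and each is controlled from
  both sides by an unbounded increasing function of its variable, so \<open>u\<close> itself lies between
  two functions of \<open>-t + |x|\<^sup>2\<close>, the lower of which tends to infinity while the upper is monotone;
  the equivalence follows (\<open>filterlim_at_top_iff_of_bounds\<close>).\<close>

section \<open>Two-sided control and divergence\<close>

text \<open>The divergence of \<open>G\<close> carries \<open>s \<rightarrow> \<infinity>\<close> over to \<open>u\<close>. Conversely, monotonicity of \<open>F\<close> bounds
  \<open>u\<close> by \<open>F Z\<close> wherever \<open>s < Z\<close> (for \<open>Z \<ge> 0\<close>), so values of \<open>u\<close> above \<open>F Z\<close> force \<open>s \<ge> Z\<close>.\<close>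

lemma filterlim_at_top_iff_of_bounds:
  fixes u s :: "'a \<Rightarrow> real" and F G :: "real \<Rightarrow> real"
  assumes nonneg: "\<And>i. 0 \<le> s i"
    and lower: "\<And>i. G (s i) \<le> u i" and upper: "\<And>i. u i \<le> F (s i)"
    and G: "filterlim G at_top at_top"
    and F: "\<And>a b. 0 \<le> a \<Longrightarrow> a \<le> b \<Longrightarrow> F a \<le> F b"
  shows "filterlim u at_top L \<longleftrightarrow> filterlim s at_top L"
proof
  assume "filterlim s at_top L"
  then have "filterlim (\<lambda>i. G (s i)) at_top L"
    by (rule filterlim_compose[OF G])
  then show "filterlim u at_top L"
    by (rule filterlim_at_top_mono) (simp add: lower)
next
  assume u: "filterlim u at_top L"
  show "filterlim s at_top L"
    unfolding filterlim_at_top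
  proof
    fix Z
    have "eventually (\<lambda>i. F (max 0 Z) < u i) L"
      using u by (simp add: filterlim_at_top_dense)
    then show "eventually (\<lambda>i. Z \<le> s i) L"
    proof eventually_elim
      case (elim i)
      show ?case
      proof (rule ccontr)
        assume "\<not> Z \<le> s i"
        then have "F (s i) \<le> F (max 0 Z)"
          using F nonneg by simp
        with elim upper[of i] show False by linarith
      qed
    qed
  qed
qed

section \<open>Growth of the radial profile\<close>

lemma power2_powr_half:
  fixes x :: real
  assumes "0 \<le> x"
  shows "(x\<^sup>2) powr (a / 2) = x powr a"
proof -
  have "x\<^sup>2 = x powr 2" using assms by simp
  then show ?thesis by (simp only: powr_powr) simp
qed

text \<open>This is the exponent for which both sides of the radial equation scale alike: with
  \<open>v = r\<^bsup>q\<^esup>\<close>, equality of the powers \<open>q - 1\<close> and \<open>1 - q/(k\<alpha>)\<close> of \<open>r\<close> gives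
  \<open>q = 2k\<alpha>/(k\<alpha> + 1)\<close>.\<close>

definition growth_exponent :: "nat \<Rightarrow> real \<Rightarrow> real" where
  "growth_exponent k \<alpha> = 2 * real k * \<alpha> / (real k * \<alpha> + 1)"

text \<open>The coefficients of the estimates are explicit functions of the data and do not involve the
  solution \<open>v\<close>, so that one pair of constants serves every solution. In the short
  notation introduced below, \<open>A\<close> and \<open>B\<close> are the coefficients in
  \<open>v\<^bsup>1/(k\<alpha>)\<^esup> v' \<ge> A r\<close> and \<open>v' \<le> B r\<^bsup>q-1\<^esup>\<close>, and \<open>\<Lambda>\<^sub>1\<close> and
  \<open>\<Lambda>\<^sub>2\<close> are what integrating these two inequalities gives.\<close>

definition lower_slope_coeff :: "nat \<Rightarrow> nat \<Rightarrow> real \<Rightarrow> real \<Rightarrow> real" where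
  "lower_slope_coeff n k \<alpha> m = (m powr (1 / \<alpha>) / real (n choose k)) powr (1 / real k)"

definition lower_growth_coeff :: "nat \<Rightarrow> nat \<Rightarrow> real \<Rightarrow> real \<Rightarrow> real" where
  "lower_growth_coeff n k \<alpha> m =
     ((real k * \<alpha> + 1) / (real k * \<alpha>) * lower_slope_coeff n k \<alpha> m / 2)
       powr (growth_exponent k \<alpha> / 2)"

definition upper_slope_coeff :: "nat \<Rightarrow> nat \<Rightarrow> real \<Rightarrow> real \<Rightarrow> real \<Rightarrow> real" where
  "upper_slope_coeff n k \<alpha> m M =
     (real n / real (n choose k) * (M / lower_growth_coeff n k \<alpha> m) powr (1 / \<alpha>)
        / (real n - 2 * real k / (real k * \<alpha> + 1))) powr (1 / real k)"

definition upper_growth_coeff :: "nat \<Rightarrow> nat \<Rightarrow> real \<Rightarrow> real \<Rightarrow> real \<Rightarrow> real" where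
  "upper_growth_coeff n k \<alpha> m M =
     upper_slope_coeff n k \<alpha> m M / growth_exponent k \<alpha>"

locale radial_data =
  fixes n k :: nat and \<alpha> m M :: real and f :: "real \<Rightarrow> real"
  assumes k_pos: "1 \<le> k" and k_le_n: "k \<le> n"
    and alpha_pos: "0 < \<alpha>"
    and alpha_gt: "(2 * real k - real n) / (real k * real n) < \<alpha>"
    and m_pos: "0 < m"
    and f_bounds: "\<And>r. 0 \<le> r \<Longrightarrow> m \<le> f r \<and> f r \<le> M"
    and f_cont: "continuous_on {0..} f"
begin

abbreviation "C \<equiv> real (n choose k)"
abbreviation "e \<equiv> real k * \<alpha> + 1"
abbreviation "p \<equiv> (real k * \<alpha> + 1) / (real k * \<alpha>)"
abbreviation "q \<equiv> growth_exponent k \<alpha>"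
abbreviation "A \<equiv> lower_slope_coeff n k \<alpha> m"
abbreviation "B \<equiv> upper_slope_coeff n k \<alpha> m M"
abbreviation "\<Lambda>\<^sub>1 \<equiv> lower_growth_coeff n k \<alpha> m"
abbreviation "\<Lambda>\<^sub>2 \<equiv> upper_growth_coeff n k \<alpha> m M"

lemma basic_pos: "0 < real k" "0 < real n" "0 < C" "0 < real k * \<alpha>" "0 < e" "0 < p" "0 < q" "0 < M"
proof -
  show "0 < real k" "0 < real n" "0 < C" using k_pos k_le_n by auto
  then show ka: "0 < real k * \<alpha>" using alpha_pos by simp
  then show e: "0 < e" by simp
  show "0 < p" by (rule divide_pos_pos[OF e ka])
  have "0 < 2 * real k * \<alpha>" using ka by (simp only: mult.assoc)
  then show "0 < q" unfolding growth_exponent_def using e by (rule divide_pos_pos)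
  show "0 < M" using m_pos f_bounds[of 0] by linarith
qed

text \<open>This is the form in which the lower bound on \<open>\<alpha>\<close> enters: it makes
  \<open>s\<^bsup>n-1-2k/(k\<alpha>+1)\<^esup>\<close> integrable at 0.\<close>

lemma singular_exponent_lt: "2 * real k / e < real n"
proof -
  have "2 * real k - real n < \<alpha> * (real k * real n)"
    using alpha_gt basic_pos by (simp add: divide_less_eq)
  then have "2 * real k < real n * e" by (simp add: algebra_simps)
  then show ?thesis using basic_pos by (simp add: divide_less_eq)
qed

lemma coeff_pos: "0 < A" "0 < \<Lambda>\<^sub>1" "0 < B" "0 < \<Lambda>\<^sub>2"
proof -
  show A: "0 < A" unfolding lower_slope_coeff_def using m_pos basic_pos by simp
  then have "0 < p * A / 2" by (intro divide_pos_pos mult_pos_pos basic_pos(6)) auto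
  then show L: "0 < \<Lambda>\<^sub>1"
    unfolding lower_growth_coeff_def by (simp only: powr_gt_zero)
  have "0 < real n / C * (M / \<Lambda>\<^sub>1) powr (1 / \<alpha>) / (real n - 2 * real k / e)"
    using L basic_pos(2,3,8) singular_exponent_lt
    by (intro divide_pos_pos mult_pos_pos) (simp_all only: powr_gt_zero, simp_all)
  then show "0 < B" unfolding upper_slope_coeff_def by (simp only: powr_gt_zero)
  then show "0 < \<Lambda>\<^sub>2" unfolding upper_growth_coeff_def using basic_pos(7) by (intro divide_pos_pos)
qed

text \<open>Both bounds on \<open>v'\<close> come from comparing the integral with \<open>x r\<^bsup>n-a\<^esup>\<close>: for the lower one
  \<open>a = 0\<close>, for the upper one \<open>a = 2k/(k\<alpha> + 1)\<close>. In both cases the power of \<open>r\<close> that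
  remains in \<open>v'\<close> does not depend on \<open>n\<close>.\<close>

lemma flux_scaling:
  assumes "0 < r" "0 < x"
  shows "(real n * r powi (int k - int n) / C * (r powr (real n - a) * x)) powr (1 / real k)
    = (real n / C * x) powr (1 / real k) * r powr (1 - a / real k)"
proof -
  have "r powi (int k - int n) = r powr (real k - real n)"
    using assms by (simp add: powr_real_of_int' [symmetric])
  moreover have "r powr (real k - real n) * r powr (real n - a) = r powr (real k - a)"
    by (simp add: powr_add [symmetric])
  ultimately have "real n * r powi (int k - int n) / C * (r powr (real n - a) * x)
      = (real n / C * x) * r powr (real k - a)"
    by (simp add: field_simps)
  moreover have "(real k - a) * (1 / real k) = 1 - a / real k"
    using basic_pos by (simp add: field_simps)
  moreover have "0 < real n / C * x" using assms basic_pos by (intro mult_pos_pos) auto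
  ultimately show ?thesis
    using assms by (simp only: powr_mult powr_powr powr_ge_zero less_imp_le)
qed

end

locale radial_profile = radial_data +
  fixes v :: "real \<Rightarrow> real"
  assumes solution: "radial_solution n k \<alpha> f v"
begin

definition slope :: "real \<Rightarrow> real" where
  "slope r = (real n * r powi (int k - int n) / C *
     integral {0..r} (\<lambda>s. s ^ (n - 1) * (f s / v s) powr (1 / \<alpha>))) powr (1 / real k)"

lemma v_pos: "0 \<le> r \<Longrightarrow> 0 < v r"
  and v_0: "v 0 = 1"
  and v_deriv: "0 < r \<Longrightarrow> (v has_real_derivative slope r) (at r)"
  using solution unfolding radial_solution_def slope_def by auto

lemma v_cont: "continuous_on {0..} v"
  using solution unfolding radial_solution_def C2_halfline_def
  by (auto intro: DERIV_continuous_on)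

lemma v_mono:
  assumes "0 \<le> a" "a \<le> b"
  shows "v a \<le> v b"
proof (rule DERIV_nonneg_imp_increasing_open[OF assms(2)])
  show "\<exists>y. (v has_real_derivative y) (at x) \<and> 0 \<le> y" if "a < x" "x < b" for x
    using v_deriv[of x] that assms by (auto simp: slope_def)
  show "continuous_on {a..b} v"
    using assms by (intro continuous_on_subset[OF v_cont]) auto
qed

lemma v_ge_1: "0 \<le> r \<Longrightarrow> 1 \<le> v r"
  using v_mono[of 0 r] v_0 by simp

lemma integrand_integrable:
  "(\<lambda>s. s ^ (n - 1) * (f s / v s) powr (1 / \<alpha>)) integrable_on {0..r}"
proof (rule integrable_continuous_real)
  have f: "continuous_on {0..r} f" and v: "continuous_on {0..r} v"
    by (auto intro: continuous_on_subset[OF f_cont] continuous_on_subset[OF v_cont])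
  have "0 < f s / v s" if "s \<in> {0..r}" for s
    using that v_pos[of s] f_bounds[of s] m_pos by auto
  then show "continuous_on {0..r} (\<lambda>s. s ^ (n - 1) * (f s / v s) powr (1 / \<alpha>))"
    using v_pos by (intro continuous_intros f v) fastforce+
qed

text \<open>Monotonicity of \<open>v\<close> allows \<open>v s\<close> to be replaced by \<open>v r\<close> in the integral, which
  decouples the equation.\<close>

lemma slope_ge:
  assumes r: "0 < r"
  shows "A * r * v r powr (- 1 / (real k * \<alpha>)) \<le> slope r"
proof -
  let ?x = "(m / v r) powr (1 / \<alpha>)"
  have vr: "0 < v r" using v_pos r by simp
  have int: "((\<lambda>s. s powr (real n - 1) * ?x) has_integral (r powr real n / real n * ?x)) {0..r}"
    by (rule has_integral_mult_left)
      (use has_integral_powr_from_0[of "real n - 1" r] r basic_pos in simp)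
  have "r powr real n / real n * ?x
      \<le> integral {0..r} (\<lambda>s. s ^ (n - 1) * (f s / v s) powr (1 / \<alpha>))"
  proof (rule has_integral_le[OF int integrable_integral[OF integrand_integrable]])
    fix s assume s: "s \<in> {0..r}"
    \<comment> \<open>Equality can fail only at \<open>s = 0\<close> with \<open>n = 1\<close>, where the left-hand side is
      0 and the right-hand side is 1.\<close>
    have "s powr (real n - 1) \<le> s ^ (n - 1)"
      using s k_pos k_le_n by (cases "s = 0") (auto simp: powr_realpow[symmetric] of_nat_diff)
    moreover have "m / v r \<le> f s / v s"
      using s v_mono[of s r] v_pos[of s] f_bounds[of s] m_pos by (intro frac_le) auto
    then have "?x \<le> (f s / v s) powr (1 / \<alpha>)"
      using m_pos vr alpha_pos by (intro powr_mono2) auto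
    ultimately show "s powr (real n - 1) * ?x \<le> s ^ (n - 1) * (f s / v s) powr (1 / \<alpha>)"
      using s by (intro mult_mono) auto
  qed
  then have "(real n * r powi (int k - int n) / C * (r powr (real n - 0) * (?x / real n)))
      powr (1 / real k) \<le> slope r"
    unfolding slope_def using r basic_pos
    by (intro powr_mono2 mult_left_mono) auto
  then have "(?x / C) powr (1 / real k) * r \<le> slope r"
    using flux_scaling[of r "?x / real n" 0] r vr m_pos basic_pos by simp
  moreover have "(?x / C) powr (1 / real k) = A * v r powr (- 1 / (real k * \<alpha>))"
  proof -
    have "?x / C = m powr (1 / \<alpha>) / C * v r powr (- 1 / \<alpha>)"
      using vr m_pos by (simp add: powr_divide powr_minus_divide)
    moreover have "0 \<le> m powr (1 / \<alpha>) / C" by simp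
    moreover have "- 1 / \<alpha> * (1 / real k) = - 1 / (real k * \<alpha>)" by simp
    ultimately show ?thesis
      unfolding lower_slope_coeff_def by (simp only: powr_mult powr_powr powr_ge_zero)
  qed
  ultimately show ?thesis by (simp add: mult_ac)
qed

text \<open>The function \<open>v\<^bsup>p\<^esup> - (p A / 2) r\<^sup>2\<close> is nondecreasing: \<open>p - 1 = 1/(k\<alpha>)\<close> is the power of \<open>v\<close>
  that cancels the one in \<open>slope_ge\<close>.\<close>

lemma profile_power_lower_bound:
  assumes r: "0 \<le> r"
  shows "1 + p * A / 2 * r\<^sup>2 \<le> v r powr p"
proof -
  have "v 0 powr p - p * A / 2 * 0\<^sup>2 \<le> v r powr p - p * A / 2 * r\<^sup>2"
  proof (rule DERIV_nonneg_imp_increasing_open[OF r])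
    fix x assume x: "0 < x" "x < r"
    have vx: "0 < v x" using v_pos x by simp
    have "((\<lambda>x. v x powr p) has_real_derivative p * v x powr (p - 1) * slope x) (at x)"
      by (rule DERIV_chain2[OF has_real_derivative_powr[OF vx] v_deriv[OF x(1)]])
    moreover have "((\<lambda>x. c / 2 * x\<^sup>2) has_real_derivative c * x) (at x)" for c :: real
      by (auto intro!: derivative_eq_intros)
    ultimately have "((\<lambda>x. v x powr p - p * A / 2 * x\<^sup>2) has_real_derivative
        p * v x powr (p - 1) * slope x - p * A * x) (at x)"
      by (rule DERIV_diff)
    moreover have "p * A * x \<le> p * v x powr (p - 1) * slope x"
    proof -
      have "p - 1 = 1 / (real k * \<alpha>)" using basic_pos(1) alpha_pos by (simp add: add_divide_distrib)
      then have "v x powr (p - 1) * v x powr (- 1 / (real k * \<alpha>)) = 1"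
        using vx by (simp add: powr_add[symmetric])
      then have "A * x = v x powr (p - 1) * (A * x * v x powr (- 1 / (real k * \<alpha>)))"
        by (simp add: algebra_simps)
      also have "\<dots> \<le> v x powr (p - 1) * slope x"
        by (rule mult_left_mono[OF slope_ge[OF x(1)]]) simp
      finally have "p * (A * x) \<le> p * (v x powr (p - 1) * slope x)"
        using basic_pos by (intro mult_left_mono) auto
      then show ?thesis by (simp add: mult.assoc)
    qed
    ultimately show "\<exists>y. ((\<lambda>x. v x powr p - p * A / 2 * x\<^sup>2) has_real_derivative y) (at x) \<and> 0 \<le> y"
      by (intro exI[of _ "p * v x powr (p - 1) * slope x - p * A * x"]) simp
  next
    have v: "continuous_on {0..r} v" by (rule continuous_on_subset[OF v_cont]) auto
    show "continuous_on {0..r} (\<lambda>x. v x powr p - p * A / 2 * x\<^sup>2)"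
      using v_pos by (intro continuous_intros v) fastforce+
  qed
  then show ?thesis by (simp add: v_0)
qed

text \<open>Dropping the 1 and taking the \<open>p\<close>-th root gives the pure power, since \<open>1/p = q/2\<close>.\<close>

lemma profile_lower_bound:
  assumes r: "0 \<le> r"
  shows "\<Lambda>\<^sub>1 * r powr q \<le> v r"
proof (cases "r = 0")
  case True
  then show ?thesis by (simp add: v_0)
next
  case False
  with r have r: "0 < r" by simp
  have cancel: "p * (q / 2) = 1"
    using basic_pos(1,5) alpha_pos unfolding growth_exponent_def by simp
  have "p * A / 2 * r\<^sup>2 \<le> v r powr p"
    using profile_power_lower_bound[of r] r by simp
  then have "(p * A / 2 * r\<^sup>2) powr (q / 2) \<le> (v r powr p) powr (q / 2)"
    using basic_pos coeff_pos r by (intro powr_mono2) auto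
  also have "\<dots> = v r"
    unfolding powr_powr cancel using v_pos[of r] r by simp
  also have "(p * A / 2 * r\<^sup>2) powr (q / 2) = \<Lambda>\<^sub>1 * (r\<^sup>2) powr (q / 2)"
    unfolding lower_growth_coeff_def using basic_pos coeff_pos r by (intro powr_mult)
  also have "(r\<^sup>2) powr (q / 2) = r powr q"
    using r by (intro power2_powr_half) simp
  finally show ?thesis .
qed

text \<open>The lower bound on \<open>v\<close> is inserted into the integral. It degenerates at \<open>s = 0\<close>, so the
  integrand is dominated by a possibly singular, but integrable, power. In return the bound on
  \<open>v'\<close> is a single power of \<open>r\<close>, valid for all \<open>r > 0\<close>.\<close>

lemma slope_le:
  assumes r: "0 < r"
  shows "slope r \<le> B * r powr (q - 1)"
proof -
  let ?a = "2 * real k / e" and ?x = "(M / \<Lambda>\<^sub>1) powr (1 / \<alpha>)"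
  let ?F = "\<lambda>s. s ^ (n - 1) * (f s / v s) powr (1 / \<alpha>)"
  have gap: "0 < real n - ?a" using singular_exponent_lt by simp
  have int: "((\<lambda>s. s powr (real n - ?a - 1) * ?x) has_integral
      (r powr (real n - ?a) / (real n - ?a) * ?x)) {0..r}"
    by (rule has_integral_mult_left)
      (use has_integral_powr_from_0[of "real n - ?a - 1" r] r gap in simp)
  \<comment> \<open>The comparison fails at \<open>s = 0\<close> if \<open>n = 1\<close>, because there the right-hand side
    has the value 0; the integrand is therefore changed at this one point.\<close>
  have F0: "((\<lambda>s. if s = 0 then 0 else ?F s) has_integral integral {0..r} ?F) {0..r}"
    by (rule has_integral_spike[OF _ _ integrable_integral[OF integrand_integrable], of "{0}"]) auto
  have "integral {0..r} ?F \<le> r powr (real n - ?a) / (real n - ?a) * ?x"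
  proof (rule has_integral_le[OF F0 int])
    fix s assume s: "s \<in> {0..r}"
    show "(if s = 0 then 0 else ?F s) \<le> s powr (real n - ?a - 1) * ?x"
    proof (cases "s = 0")
      case False
      with s have s: "0 < s" by simp
      have "f s / v s \<le> M / (\<Lambda>\<^sub>1 * s powr q)"
        using s f_bounds[of s] basic_pos coeff_pos profile_lower_bound[of s]
        by (intro frac_le) auto
      then have "(f s / v s) powr (1 / \<alpha>) \<le> (M / (\<Lambda>\<^sub>1 * s powr q)) powr (1 / \<alpha>)"
        using s f_bounds[of s] m_pos v_pos[of s] alpha_pos by (intro powr_mono2) auto
      also have "\<dots> = ?x * s powr (- ?a)"
      proof -
        have "M / (\<Lambda>\<^sub>1 * s powr q) = M / \<Lambda>\<^sub>1 * s powr (- q)"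
          by (simp add: powr_minus_divide)
        moreover have "- q * (1 / \<alpha>) = - ?a" using alpha_pos by (simp add: growth_exponent_def)
        ultimately show ?thesis
          using s basic_pos coeff_pos by (simp only: powr_mult powr_powr)
      qed
      finally have "?F s \<le> s ^ (n - 1) * (?x * s powr (- ?a))"
        using s by (intro mult_left_mono) auto
      also have "\<dots> = s powr (real n - 1) * (?x * s powr (- ?a))"
        using s k_pos k_le_n by (simp add: powr_realpow[symmetric] of_nat_diff)
      also have "\<dots> = s powr (real n - 1 + - ?a) * ?x"
        by (simp only: powr_add mult_ac)
      also have "real n - 1 + - ?a = real n - ?a - 1" by simp
      finally show ?thesis using False by (simp only: if_False)
    qed simp
  qed
  moreover have "0 \<le> integral {0..r} ?F"
    by (intro integral_nonneg integrand_integrable) auto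
  ultimately have "slope r \<le> (real n * r powi (int k - int n) / C *
      (r powr (real n - ?a) * (?x / (real n - ?a)))) powr (1 / real k)"
    unfolding slope_def using r basic_pos by (intro powr_mono2 mult_left_mono) auto
  also have "\<dots> = (real n / C * (?x / (real n - ?a))) powr (1 / real k) * r powr (1 - ?a / real k)"
    using gap coeff_pos basic_pos by (intro flux_scaling r) auto
  also have "1 - ?a / real k = q - 1"
    using basic_pos(1,5) unfolding growth_exponent_def by (simp add: divide_simps)
  finally show ?thesis unfolding upper_slope_coeff_def by simp
qed

lemma profile_upper_bound:
  assumes r: "0 \<le> r"
  shows "v r \<le> 1 + \<Lambda>\<^sub>2 * r powr q"
proof -
  have "\<Lambda>\<^sub>2 * 0 powr q - v 0 \<le> \<Lambda>\<^sub>2 * r powr q - v r"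
  proof (rule DERIV_nonneg_imp_increasing_open[OF r])
    fix x assume x: "0 < x" "x < r"
    have "((\<lambda>x. \<Lambda>\<^sub>2 * x powr q - v x) has_real_derivative
        \<Lambda>\<^sub>2 * (q * x powr (q - 1)) - slope x) (at x)"
      by (intro DERIV_diff DERIV_cmult has_real_derivative_powr v_deriv x)
    moreover have "\<Lambda>\<^sub>2 * q = B" unfolding upper_growth_coeff_def using basic_pos(7) by simp
    then have "\<Lambda>\<^sub>2 * (q * x powr (q - 1)) = B * x powr (q - 1)"
      by (simp only: mult.assoc[symmetric])
    ultimately show "\<exists>y. ((\<lambda>x. \<Lambda>\<^sub>2 * x powr q - v x) has_real_derivative y) (at x) \<and> 0 \<le> y"
      using slope_le[OF x(1)] by auto
  next
    have v: "continuous_on {0..r} v" by (rule continuous_on_subset[OF v_cont]) auto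
    show "continuous_on {0..r} (\<lambda>x. \<Lambda>\<^sub>2 * x powr q - v x)"
      using basic_pos(7) by (intro continuous_intros continuous_on_powr' v) auto
  qed
  then show ?thesis by (simp add: v_0)
qed

end

section \<open>The time factor and the separable solution\<close>

lemma integral_between_linear:
  fixes g :: "real \<Rightarrow> real"
  assumes "continuous_on {..0} g" and bounds: "\<And>t. t \<le> 0 \<Longrightarrow> m \<le> g t \<and> g t \<le> M" and t: "t \<le> 0"
  shows "m * - t \<le> integral {t..0} g" "integral {t..0} g \<le> M * - t"
proof -
  have g: "(g has_integral integral {t..0} g) {t..0}"
    by (intro integrable_integral integrable_continuous_real continuous_on_subset[OF assms(1)]) auto
  have c: "((\<lambda>_. c) has_integral c * - t) {t..0}" for c :: real
    using has_integral_const_real[of c t 0] t by (simp add: mult.commute)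
  show "m * - t \<le> integral {t..0} g"
    by (rule has_integral_le[OF c g]) (simp add: bounds)
  show "integral {t..0} g \<le> M * - t"
    by (rule has_integral_le[OF g c]) (simp add: bounds)
qed

context radial_profile
begin

abbreviation "\<gamma> \<equiv> 1 / (real k * \<alpha> + 1)"
abbreviation "K \<equiv> (real k * \<alpha> + 1) powr \<gamma>"

text \<open>If \<open>-t + |x|\<^sup>2 = s\<close>, then \<open>-t \<ge> s/2\<close> or \<open>|x|\<^sup>2 \<ge> s/2\<close>, and the factor in the
  other variable is bounded below; hence the minimum.\<close>

lemma separable_solution_lower_bound:
  fixes x :: "real ^ 'd"
  assumes g: "continuous_on {..0} g" "\<And>t. t \<le> 0 \<Longrightarrow> mg \<le> g t \<and> g t \<le> Mg" "0 < mg" and t: "t \<le> 0"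
    and s: "s = - t + (norm x)\<^sup>2"
  shows "K * min ((1 + mg * (s / 2)) powr \<gamma>) (\<Lambda>\<^sub>1 * (s / 2) powr (q / 2))
    \<le> separable_solution k \<alpha> g v x t"
proof -
  let ?W = "(1 + integral {t..0} g) powr \<gamma>" and ?V = "v (norm x)"
  have I: "mg * - t \<le> integral {t..0} g" by (rule integral_between_linear[OF g(1,2) t])
  have I0: "0 \<le> mg * - t" using g(3) t by (simp add: mult_nonneg_nonpos)
  have s0: "0 \<le> s" unfolding s using t by (intro add_nonneg_nonneg) auto
  have W1: "1 \<le> ?W" using I I0 basic_pos by (intro ge_one_powr_ge_zero) auto
  have V1: "1 \<le> ?V" by (simp add: v_ge_1)
  have "min ((1 + mg * (s / 2)) powr \<gamma>) (\<Lambda>\<^sub>1 * (s / 2) powr (q / 2)) \<le> ?W * ?V"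
  proof (cases "s / 2 \<le> - t")
    case True
    then have "mg * (s / 2) \<le> mg * - t" using g(3) by (intro mult_left_mono) auto
    with I have "(1 + mg * (s / 2)) powr \<gamma> \<le> ?W"
      using basic_pos g(3) s0 by (intro powr_mono2) auto
    also have "\<dots> \<le> ?W * ?V" using mult_left_mono[OF V1, of ?W] by simp
    finally show ?thesis by linarith
  next
    case False
    with s have "s / 2 \<le> (norm x)\<^sup>2" by simp
    then have "(s / 2) powr (q / 2) \<le> ((norm x)\<^sup>2) powr (q / 2)"
      using s0 basic_pos(7) by (intro powr_mono2) auto
    also have "\<dots> = norm x powr q" by (simp add: power2_powr_half)
    finally have "\<Lambda>\<^sub>1 * (s / 2) powr (q / 2) \<le> \<Lambda>\<^sub>1 * norm x powr q"
      using coeff_pos by (intro mult_left_mono) auto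
    also have "\<dots> \<le> ?V" by (simp add: profile_lower_bound)
    also have "\<dots> \<le> ?W * ?V" using mult_right_mono[OF W1, of ?V] V1 by simp
    finally show ?thesis by linarith
  qed
  then have "K * min ((1 + mg * (s / 2)) powr \<gamma>) (\<Lambda>\<^sub>1 * (s / 2) powr (q / 2)) \<le> K * (?W * ?V)"
    by (intro mult_left_mono) auto
  then show ?thesis
    unfolding separable_solution_def time_factor_def by (simp add: mult.assoc)
qed

lemma separable_solution_upper_bound:
  fixes x :: "real ^ 'd"
  assumes g: "continuous_on {..0} g" "\<And>t. t \<le> 0 \<Longrightarrow> mg \<le> g t \<and> g t \<le> Mg" "0 < mg" and t: "t \<le> 0"
    and s: "s = - t + (norm x)\<^sup>2"
  shows "separable_solution k \<alpha> g v x t \<le> K * (1 + Mg * s) powr \<gamma> * (1 + \<Lambda>\<^sub>2 * s powr (q / 2))"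
proof -
  have I: "mg * - t \<le> integral {t..0} g" "integral {t..0} g \<le> Mg * - t"
    using integral_between_linear[OF g(1,2) t] by blast+
  have I0: "0 \<le> mg * - t" using g(3) t by (simp add: mult_nonneg_nonpos)
  have "0 < Mg" using g(2)[of 0] g(3) by simp
  then have "Mg * - t \<le> Mg * s" using s by (intro mult_left_mono) auto
  with I I0 have W: "(1 + integral {t..0} g) powr \<gamma> \<le> (1 + Mg * s) powr \<gamma>"
    using basic_pos by (intro powr_mono2) auto
  have "norm x powr q = ((norm x)\<^sup>2) powr (q / 2)"
    by (simp add: power2_powr_half)
  also have "\<dots> \<le> s powr (q / 2)"
    using s t basic_pos(7) by (intro powr_mono2) auto
  finally have "\<Lambda>\<^sub>2 * norm x powr q \<le> \<Lambda>\<^sub>2 * s powr (q / 2)"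
    using coeff_pos by (intro mult_left_mono) auto
  with profile_upper_bound[of "norm x"] have V: "v (norm x) \<le> 1 + \<Lambda>\<^sub>2 * s powr (q / 2)" by simp
  show ?thesis
    unfolding separable_solution_def time_factor_def
    using W V v_pos[of "norm x"] by (intro mult_mono) auto
qed

lemma separable_solution_at_top_iff:
  fixes x :: "'i \<Rightarrow> real ^ 'd"
  assumes g: "continuous_on {..0} g" "\<And>t. t \<le> 0 \<Longrightarrow> mg \<le> g t \<and> g t \<le> Mg" "0 < mg"
    and t: "\<And>i. t i \<le> 0"
  shows "filterlim (\<lambda>i. separable_solution k \<alpha> g v (x i) (t i)) at_top L \<longleftrightarrow>
         filterlim (\<lambda>i. - t i + (norm (x i))\<^sup>2) at_top L"
proof (rule filterlim_at_top_iff_of_bounds)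
  show "0 \<le> - t i + (norm (x i))\<^sup>2" for i using t[of i] by (intro add_nonneg_nonneg) auto
  let ?s = "\<lambda>i. - t i + (norm (x i))\<^sup>2"
  show "K * min ((1 + mg * (?s i / 2)) powr \<gamma>) (\<Lambda>\<^sub>1 * (?s i / 2) powr (q / 2))
      \<le> separable_solution k \<alpha> g v (x i) (t i)" for i
    by (rule separable_solution_lower_bound[OF g t refl])
  show "separable_solution k \<alpha> g v (x i) (t i)
      \<le> K * (1 + Mg * ?s i) powr \<gamma> * (1 + \<Lambda>\<^sub>2 * ?s i powr (q / 2))" for i
    by (rule separable_solution_upper_bound[OF g t refl])
next
  have half: "filterlim (\<lambda>s::real. s / 2) at_top at_top"
    using filterlim_tendsto_pos_mult_at_top[OF tendsto_const[of "1/2::real"] _ filterlim_ident] by simp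
  have "filterlim (\<lambda>s. 1 + mg * (s / 2)) at_top at_top"
    by (intro filterlim_tendsto_add_at_top[OF tendsto_const]
        filterlim_tendsto_pos_mult_at_top[OF tendsto_const g(3)] half)
  then have 1: "filterlim (\<lambda>s. (1 + mg * (s / 2)) powr \<gamma>) at_top at_top"
    using basic_pos by (intro filterlim_compose[OF real_powr_at_top]) auto
  have 2: "filterlim (\<lambda>s. \<Lambda>\<^sub>1 * (s / 2) powr (q / 2)) at_top at_top"
    by (intro filterlim_tendsto_pos_mult_at_top[OF tendsto_const coeff_pos(2)]
        filterlim_compose[OF real_powr_at_top[OF half_gt_zero[OF basic_pos(7)]] half])
  have "filterlim (\<lambda>s. min ((1 + mg * (s / 2)) powr \<gamma>) (\<Lambda>\<^sub>1 * (s / 2) powr (q / 2))) at_top at_top"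
    using 1 2 unfolding filterlim_at_top by (auto intro: eventually_conj)
  then show "filterlim (\<lambda>s. K * min ((1 + mg * (s / 2)) powr \<gamma>) (\<Lambda>\<^sub>1 * (s / 2) powr (q / 2)))
      at_top at_top"
    using basic_pos by (intro filterlim_tendsto_pos_mult_at_top[OF tendsto_const]) auto
next
  fix a b :: real assume ab: "0 \<le> a" "a \<le> b"
  have Mg: "0 < Mg" using g(2)[of 0] g(3) by simp
  then have "(1 + Mg * a) powr \<gamma> \<le> (1 + Mg * b) powr \<gamma>"
    using ab basic_pos by (intro powr_mono2) auto
  moreover have "a powr (q / 2) \<le> b powr (q / 2)"
    using ab basic_pos(7) by (intro powr_mono2) auto
  ultimately show "K * (1 + Mg * a) powr \<gamma> * (1 + \<Lambda>\<^sub>2 * a powr (q / 2))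
      \<le> K * (1 + Mg * b) powr \<gamma> * (1 + \<Lambda>\<^sub>2 * b powr (q / 2))"
    using coeff_pos by (intro mult_mono mult_left_mono add_mono) auto
qed

end

theorem proposition1p4:
  fixes k :: nat and \<alpha> :: real and f :: "real \<Rightarrow> real"
  assumes "1 \<le> k" and "k \<le> CARD('n::finite)"
    and "continuous_on {0..} f"
    and "\<exists>m M. 0 < m \<and> (\<forall>r\<ge>0. m \<le> f r \<and> f r \<le> M)"
    and "\<alpha> > max 0 ((2 * real k - real CARD('n)) / (real k * real CARD('n)))"
  shows "(\<forall>g v. continuous_on {..0} g \<longrightarrow>
            (\<exists>m M. 0 < m \<and> (\<forall>t\<le>0. m \<le> g t \<and> g t \<le> M)) \<longrightarrow>
            radial_solution CARD('n) k \<alpha> f v \<longrightarrow>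
            (\<forall>(x :: nat \<Rightarrow> real ^ 'n) (t :: nat \<Rightarrow> real). (\<forall>i. t i \<le> 0) \<longrightarrow>
               (filterlim (\<lambda>i. separable_solution k \<alpha> g v (x i) (t i)) at_top sequentially \<longleftrightarrow>
                filterlim (\<lambda>i. - t i + (norm (x i))\<^sup>2) at_top sequentially)))
       \<and> (\<exists>\<Lambda>\<^sub>1>0. \<exists>\<Lambda>\<^sub>2>0. \<forall>v. radial_solution CARD('n) k \<alpha> f v \<longrightarrow>
            (\<forall>r\<ge>0. \<Lambda>\<^sub>1 * r powr (2 * real k * \<alpha> / (real k * \<alpha> + 1)) \<le> v r \<and>
                    v r \<le> 1 + \<Lambda>\<^sub>2 * r powr (2 * real k * \<alpha> / (real k * \<alpha> + 1))))"
proof -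
  obtain m M where mM: "0 < m" "\<And>r. 0 \<le> r \<Longrightarrow> m \<le> f r \<and> f r \<le> M" using assms(4) by blast
  interpret radial_data "CARD('n)" k \<alpha> m M f
    using assms mM by unfold_locales auto
  have profile: "radial_profile CARD('n) k \<alpha> m M f v"
    if "radial_solution CARD('n) k \<alpha> f v" for v
    using that by unfold_locales
  show ?thesis
  proof (intro conjI allI impI)
    fix g v :: "real \<Rightarrow> real" and x :: "nat \<Rightarrow> real ^ 'n" and t :: "nat \<Rightarrow> real"
    assume g: "continuous_on {..0} g" "\<exists>m M. 0 < m \<and> (\<forall>t\<le>0. m \<le> g t \<and> g t \<le> M)"
      and v: "radial_solution CARD('n) k \<alpha> f v" and t: "\<forall>i. t i \<le> 0"
    from g(2) obtain mg Mg where mg: "0 < mg" "\<And>t. t \<le> 0 \<Longrightarrow> mg \<le> g t \<and> g t \<le> Mg" by blast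
    interpret radial_profile "CARD('n)" k \<alpha> m M f v by (rule profile[OF v])
    show "filterlim (\<lambda>i. separable_solution k \<alpha> g v (x i) (t i)) at_top sequentially \<longleftrightarrow>
          filterlim (\<lambda>i. - t i + (norm (x i))\<^sup>2) at_top sequentially"
      by (rule separable_solution_at_top_iff[OF g(1) mg(2) mg(1)]) (use t in auto)
  next
    show "\<exists>\<Lambda>\<^sub>1>0. \<exists>\<Lambda>\<^sub>2>0. \<forall>v. radial_solution CARD('n) k \<alpha> f v \<longrightarrow>
            (\<forall>r\<ge>0. \<Lambda>\<^sub>1 * r powr (2 * real k * \<alpha> / (real k * \<alpha> + 1)) \<le> v r \<and>
                    v r \<le> 1 + \<Lambda>\<^sub>2 * r powr (2 * real k * \<alpha> / (real k * \<alpha> + 1)))"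
      unfolding growth_exponent_def[symmetric]
      by (rule exI[of _ "lower_growth_coeff CARD('n) k \<alpha> m"],
          rule conjI[OF coeff_pos(2)], rule exI[of _ "upper_growth_coeff CARD('n) k \<alpha> m M"],
          intro conjI coeff_pos(4) allI impI
            radial_profile.profile_lower_bound[OF profile]
            radial_profile.profile_upper_bound[OF profile])
  qed
qed

end
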